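(* For every $\varepsilon > 0$ there is $n_0(\varepsilon)$ such that for all $n \ge n_0(\varepsilon)$ and all integers $\ell$ with $3 \le \ell \le (1-\varepsilon)\frac{\log n}{\log\log n}$ we have $$r(C_\ell, K_n) > n\log n \gg (\ell-1)(n-1)+1,$$ where the relation $\gg$ means that the ratio $\frac{(\ell-1)(n-1)+1}{n \log n}$ tends to $0$ as $n\to\infty$, uniformly over $\ell$ in the given range.
   Context: All logarithms are to base $2$. For graphs $G,H$, the Ramsey number $r(G,H)$ is the smallest natural number $N$ such that every red/blue colouring of the edges of the complete graph $K_N$ contains a red copy of $G$ or a blue copy of $H$. $C_\ell$ is the cycle of length $\ell$ and $K_n$ is the complete graph on $n$ vertices. *)

theory Defs
  imports Complex_Main "HOL-Library.Ramsey"
begin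

text \<open>A graph is a pair of a vertex set and a set of edges, each edge a 2-element set of vertices.\<close>

type_synonym 'a graph = "'a set \<times> 'a set set"

definition complete_graph :: "nat \<Rightarrow> nat graph" where
  "complete_graph n = ({..<n}, [{..<n}]\<^bsup>2\<^esup>)"

text \<open>This is the cycle on \<open>l\<close> vertices only for \<open>l \<ge> 3\<close>; smaller values are degenerate.\<close>

definition cycle_graph :: "nat \<Rightarrow> nat graph" where
  "cycle_graph l = ({..<l}, {{i, Suc i mod l} |i. i < l})"

text \<open>Copies are not required to be induced.\<close>

definition contains_copy :: "'a graph \<Rightarrow> 'b graph \<Rightarrow> bool" where
  "contains_copy H G \<longleftrightarrow>
    (\<exists>f. inj_on f (fst G) \<and> f ` fst G \<subseteq> fst H \<and> (\<forall>e \<in> snd G. f ` e \<in> snd H))"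

datatype colour = Red | Blue

definition colour_class :: "'a graph \<Rightarrow> ('a set \<Rightarrow> colour) \<Rightarrow> colour \<Rightarrow> 'a graph" where
  "colour_class K \<chi> c = (fst K, {e \<in> snd K. \<chi> e = c})"

definition ramsey_arrow :: "nat \<Rightarrow> 'a graph \<Rightarrow> 'b graph \<Rightarrow> bool" where
  "ramsey_arrow N G H \<longleftrightarrow>
    (\<forall>\<chi>. contains_copy (colour_class (complete_graph N) \<chi> Red) G \<or>
         contains_copy (colour_class (complete_graph N) \<chi> Blue) H)"

definition ramsey_number :: "'a graph \<Rightarrow> 'b graph \<Rightarrow> nat" where
  "ramsey_number G H = (LEAST N. ramsey_arrow N G H)"

text \<open>The minimum is taken over a nonempty set, so \<open>ramsey_number\<close> is meaningful
  for all finite graphs.\<close>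

lemma contains_copy_if_clique:
  assumes G: "finite (fst G)" "snd G \<subseteq> [fst G]\<^bsup>2\<^esup>"
    and X: "X \<in> [{..<N}]\<^bsup>card (fst G)\<^esup>" and col: "\<And>e. e \<in> [X]\<^bsup>2\<^esup> \<Longrightarrow> \<chi> e = c"
  shows "contains_copy (colour_class (complete_graph N) \<chi> c) G"
proof -
  have X': "X \<subseteq> {..<N}" "finite X" "card X = card (fst G)"
    using X by (auto simp: nsets_def)
  then obtain f where f: "bij_betw f (fst G) X"
    using finite_same_card_bij G(1) by metis
  have "f ` e \<in> [X]\<^bsup>2\<^esup>" if "e \<in> snd G" for e
  proof -
    have e: "e \<subseteq> fst G" "card e = 2" "finite e"
      using that G(2) by (auto simp: nsets_def)
    moreover have "inj_on f e"
      using f e(1) by (meson bij_betw_def inj_on_subset)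
    ultimately show ?thesis
      using f by (auto simp: nsets_def card_image bij_betw_def)
  qed
  then have "\<forall>e \<in> snd G. f ` e \<in> {e \<in> [{..<N}]\<^bsup>2\<^esup>. \<chi> e = c}"
    using col nsets_mono[OF X'(1)] by blast
  then show ?thesis
    unfolding contains_copy_def colour_class_def complete_graph_def
    using f X'(1) by (auto simp: bij_betw_def intro!: exI[of _ f])
qed

lemma ex_ramsey_arrow:
  assumes G: "finite (fst G)" "snd G \<subseteq> [fst G]\<^bsup>2\<^esup>"
    and H: "finite (fst H)" "snd H \<subseteq> [fst H]\<^bsup>2\<^esup>"
  shows "\<exists>N. ramsey_arrow N G H"
proof -
  obtain N :: nat where N: "partn_lst {..<N} [card (fst G), card (fst H)] 2"
    using ramsey2_full by blast
  have "contains_copy (colour_class (complete_graph N) \<chi> Red) G \<or>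
        contains_copy (colour_class (complete_graph N) \<chi> Blue) H" for \<chi>
  proof -
    define g :: "nat set \<Rightarrow> nat" where "g e = (if \<chi> e = Red then 0 else 1)" for e
    have "g \<in> [{..<N}]\<^bsup>2\<^esup> \<rightarrow> {..<2}"
      by (auto simp: g_def)
    with N obtain i where i: "i < 2"
        "monochromatic {..<N} ([card (fst G), card (fst H)] ! i) 2 g i"
      unfolding partn_lst_def by (auto simp: numeral_2_eq_2)
    then obtain X where X: "X \<in> nsets {..<N} ([card (fst G), card (fst H)] ! i)"
        "g ` [X]\<^bsup>2\<^esup> \<subseteq> {i}"
      unfolding monochromatic_def by blast
    have g: "g e = i" if "e \<in> [X]\<^bsup>2\<^esup>" for e
      using X(2) that by blast
    consider "i = 0" | "i = 1" using i(1) by linarith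
    then show ?thesis
    proof cases
      case 1
      have "\<chi> e = Red" if "e \<in> [X]\<^bsup>2\<^esup>" for e
        using g[OF that] 1 by (auto simp: g_def split: if_splits)
      then show ?thesis
        using contains_copy_if_clique[OF G] X(1) 1 by auto
    next
      case 2
      have "\<chi> e = Blue" if "e \<in> [X]\<^bsup>2\<^esup>" for e
        using g[OF that] 2 by (cases "\<chi> e") (auto simp: g_def)
      then show ?thesis
        using contains_copy_if_clique[OF H] X(1) 2 by auto
    qed
  qed
  then show ?thesis
    unfolding ramsey_arrow_def by blast
qed

lemma ex_ramsey_arrow_cycle_complete:
  assumes "l \<ge> 2"
  shows "\<exists>N. ramsey_arrow N (cycle_graph l) (complete_graph n)"
proof (rule ex_ramsey_arrow)
  have "i \<noteq> Suc i mod l" if "i < l" for i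
    using that assms by (cases "Suc i = l") auto
  then show "snd (cycle_graph l) \<subseteq> [fst (cycle_graph l)]\<^bsup>2\<^esup>"
    using assms by (auto simp: cycle_graph_def)
qed (auto simp: cycle_graph_def complete_graph_def)

end

(* Deletion method: take the random graph on about 2 n log n vertices with edge probability
   8 ln ln n / n, large enough that by the union bound independent n-sets are unlikely. Its average
   degree has order log n loglog n, so the expected number of labelled copies of C_l is at most
   (O(log n loglog n))^l \<le> n^(1 - \<epsilon> + o(1)), which is o(n); deleting one vertex from each copy
   leaves more than n log n vertices. *)
theory Submission
  imports Defs "HOL-Real_Asymp.Real_Asymp"
begin

section \<open>Random edge sets as weighted sums over \<open>Pow E\<close>\<close>

text \<open>For \<open>0 \<le> p \<le> 1\<close> this is the probability that a random subset of
  \<open>E\<close>, keeping each element independently with probability \<open>p\<close>, contains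
  \<open>A\<close> and misses \<open>B\<close>. It is a polynomial identity in \<open>p\<close>:
  expand a product of two-term sums over \<open>E\<close>, in which elements outside
  \<open>A\<close> and \<open>B\<close> contribute \<open>p + (1 - p) = 1\<close>.\<close>

lemma sum_binomial_weights:
  fixes p :: real
  assumes "finite E" "A \<subseteq> E" "B \<subseteq> E" "A \<inter> B = {}"
  shows "(\<Sum>S\<in>Pow E. of_bool (A \<subseteq> S \<and> B \<inter> S = {}) * (p ^ card S * (1 - p) ^ card (E - S)))
           = p ^ card A * (1 - p) ^ card B"
proof -
  \<comment> \<open>\<open>f e\<close> is the weight of keeping \<open>e\<close>, \<open>g e\<close>
    that of leaving it out; the zeros kill exactly those \<open>S\<close> that violate the
    condition.\<close>
  define f where "f e = (if e \<in> B then 0 else p)" for e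
  define g where "g e = (if e \<in> A then 0 else 1 - p)" for e
  have fin: "finite A" "finite B" using assms by (auto intro: finite_subset)
  have "of_bool (A \<subseteq> S \<and> B \<inter> S = {}) * (p ^ card S * (1 - p) ^ card (E - S)) = prod f S * prod g (E - S)"
    if "S \<in> Pow E" for S
  proof (cases "A \<subseteq> S \<and> B \<inter> S = {}")
    case True
    then have "prod f S = (\<Prod>e\<in>S. p)"
      by (intro prod.cong) (auto simp: f_def)
    moreover from True have "prod g (E - S) = (\<Prod>e\<in>E - S. 1 - p)"
      by (intro prod.cong) (auto simp: g_def)
    ultimately show ?thesis using True by simp
  next
    case False
    then have "(\<exists>e\<in>S. f e = 0) \<or> (\<exists>e\<in>E - S. g e = 0)"
      using assms by (auto simp: f_def g_def)
    then show ?thesis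
      using False that assms(1) finite_subset[of S E] by auto
  qed
  then have "(\<Sum>S\<in>Pow E. of_bool (A \<subseteq> S \<and> B \<inter> S = {}) * (p ^ card S * (1 - p) ^ card (E - S)))
      = (\<Prod>e\<in>E. f e + g e)"
    by (simp add: prod_add[OF assms(1)])
  also have "\<dots> = (\<Prod>e\<in>A \<union> B. f e + g e)"
    using assms by (intro prod.mono_neutral_right) (auto simp: f_def g_def)
  also have "\<dots> = (\<Prod>e\<in>A. f e + g e) * (\<Prod>e\<in>B. f e + g e)"
    using fin assms(4) by (rule prod.union_disjoint)
  also have "(\<Prod>e\<in>A. f e + g e) = (\<Prod>e\<in>A. p)"
    using assms(4) by (intro prod.cong) (auto simp: f_def g_def)
  also have "(\<Prod>e\<in>B. f e + g e) = (\<Prod>e\<in>B. 1 - p)"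
    using assms(4) by (intro prod.cong) (auto simp: f_def g_def)
  finally show ?thesis by simp
qed

text \<open>First moment method. Markov's inequality for the number of labelled copies and the union
  bound over \<open>n\<close>-sets are merged into one expectation, that of (copies) /
  \<open>K\<close> + (independent \<open>n\<close>-sets). As it is below 1, some edge set has a
  value below 1.\<close>

lemma ex_edge_set_few_copies:
  fixes p K :: real and G :: "'a graph"
  assumes G: "finite (fst G)" "snd G \<subseteq> [fst G]\<^bsup>2\<^esup>"
    and p: "0 \<le> p" "p \<le> 1" and K: "K > 0"
    and less: "real N ^ card (fst G) * p ^ card (snd G) / K +
               real (N choose n) * (1 - p) ^ (n choose 2) < 1"
  obtains S where "S \<subseteq> [{..<N}]\<^bsup>2\<^esup>"
    "real (card {f \<in> fst G \<rightarrow>\<^sub>E {..<N}. inj_on f (fst G) \<and> (\<forall>e\<in>snd G. f ` e \<in> S)}) < K"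
    "\<And>T. T \<in> [{..<N}]\<^bsup>n\<^esup> \<Longrightarrow> [T]\<^bsup>2\<^esup> \<inter> S \<noteq> {}"
proof -
  define E where "E = [{..<N}]\<^bsup>2\<^esup>"
  define F where "F = {f \<in> fst G \<rightarrow>\<^sub>E {..<N}. inj_on f (fst G)}"
  define T where "T = [{..<N}]\<^bsup>n\<^esup>"
  \<comment> \<open>\<open>w S\<close> is the probability of the edge set \<open>S\<close>,
    \<open>X S\<close> the set of labelled copies of \<open>G\<close> in it, and \<open>Y S\<close>
    the set of its independent \<open>n\<close>-sets.\<close>
  define w where "w S = p ^ card S * (1 - p) ^ card (E - S)" for S :: "nat set set"
  define X where "X S = {f \<in> F. (`) f ` snd G \<subseteq> S}" for S
  define Y where "Y S = {t \<in> T. [t]\<^bsup>2\<^esup> \<inter> S = {}}" for S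
  have finE: "finite E" and finT: "finite T"
    by (auto simp: E_def T_def intro: finite_imp_finite_nsets)
  have finPE: "finite (fst G \<rightarrow>\<^sub>E {..<N})"
    using G(1) by (intro finite_PiE) auto
  then have finF: "finite F" unfolding F_def by simp
  have w: "w S \<ge> 0" for S using p by (simp add: w_def)
  have sum_w: "(\<Sum>S\<in>Pow E. w S) = 1"
    using sum_binomial_weights[OF finE, of "{}" "{}" p] by (simp add: w_def)
  have wX: "(\<Sum>S\<in>Pow E. of_bool ((`) f ` snd G \<subseteq> S) * w S) = p ^ card (snd G)" if "f \<in> F" for f
  proof -
    have inj: "inj_on f (fst G)" and im: "f ` fst G \<subseteq> {..<N}"
      using that by (auto simp: F_def)
    have "f ` e \<in> E" if "e \<in> snd G" for e
    proof -
      have "e \<subseteq> fst G" "finite e" "card e = 2" using that G(2) by (auto simp: nsets_def)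
      then show ?thesis
        using im inj_on_subset[OF inj, of e] by (auto simp: E_def nsets_def card_image)
    qed
    then have sub: "(`) f ` snd G \<subseteq> E" by auto
    \<comment> \<open>An injective \<open>f\<close> sends distinct edges to distinct edges, so a
      copy prescribes exactly \<open>card (snd G)\<close> elements of \<open>S\<close>.\<close>
    have "snd G \<subseteq> Pow (fst G)" using G(2) by (auto simp: nsets_def)
    then have "inj_on ((`) f) (snd G)" using inj inj_on_image_Pow inj_on_subset by blast
    then show ?thesis
      using sum_binomial_weights[OF finE sub, of "{}" p] by (simp add: w_def card_image)
  qed
  have wY: "(\<Sum>S\<in>Pow E. of_bool ([t]\<^bsup>2\<^esup> \<inter> S = {}) * w S) = (1 - p) ^ (n choose 2)" if "t \<in> T" for t
  proof -
    have t: "t \<subseteq> {..<N}" "finite t" "card t = n" using that by (auto simp: T_def nsets_def)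
    have "[t]\<^bsup>2\<^esup> \<subseteq> E" unfolding E_def by (rule nsets_mono[OF t(1)])
    moreover have "card ([t]\<^bsup>2\<^esup>) = n choose 2"
      using n_subsets[OF t(2), of 2] t by (simp add: nsets_def finite_subset cong: conj_cong)
    ultimately show ?thesis
      using sum_binomial_weights[OF finE, of "{}" "[t]\<^bsup>2\<^esup>" p] by (simp add: w_def)
  qed
  have cX: "real (card (X S)) = (\<Sum>f\<in>F. of_bool ((`) f ` snd G \<subseteq> S))" for S
    using finF by (simp add: X_def Int_def)
  have cY: "real (card (Y S)) = (\<Sum>t\<in>T. of_bool ([t]\<^bsup>2\<^esup> \<inter> S = {}))" for S
    using finT by (simp add: Y_def Int_def)
  have sX: "(\<Sum>S\<in>Pow E. w S * real (card (X S))) = real (card F) * p ^ card (snd G)"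
  proof -
    have "(\<Sum>S\<in>Pow E. w S * real (card (X S)))
        = (\<Sum>S\<in>Pow E. \<Sum>f\<in>F. of_bool ((`) f ` snd G \<subseteq> S) * w S)"
      unfolding cX sum_distrib_left by (simp add: mult.commute)
    also have "\<dots> = (\<Sum>f\<in>F. \<Sum>S\<in>Pow E. of_bool ((`) f ` snd G \<subseteq> S) * w S)"
      by (rule sum.swap)
    also have "\<dots> = (\<Sum>f\<in>F. p ^ card (snd G))" by (intro sum.cong refl wX)
    finally show ?thesis by simp
  qed
  have sY: "(\<Sum>S\<in>Pow E. w S * real (card (Y S))) = real (card T) * (1 - p) ^ (n choose 2)"
  proof -
    have "(\<Sum>S\<in>Pow E. w S * real (card (Y S)))
        = (\<Sum>S\<in>Pow E. \<Sum>t\<in>T. of_bool ([t]\<^bsup>2\<^esup> \<inter> S = {}) * w S)"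
      unfolding cY sum_distrib_left by (simp add: mult.commute)
    also have "\<dots> = (\<Sum>t\<in>T. \<Sum>S\<in>Pow E. of_bool ([t]\<^bsup>2\<^esup> \<inter> S = {}) * w S)"
      by (rule sum.swap)
    also have "\<dots> = (\<Sum>t\<in>T. (1 - p) ^ (n choose 2))" by (intro sum.cong refl wY)
    finally show ?thesis by simp
  qed
  have "card F \<le> card (fst G \<rightarrow>\<^sub>E {..<N})"
    unfolding F_def by (rule card_mono[OF finPE]) auto
  also have "\<dots> = N ^ card (fst G)" using G(1) by (simp add: card_funcsetE)
  finally have cF: "real (card F) \<le> real N ^ card (fst G)"
    by (simp flip: of_nat_power)
  have cT: "card T = N choose n"
    using binomial_eq_nsets[of N n] by (simp add: T_def lessThan_atLeast0)
  \<comment> \<open>Averaging: if every \<open>S\<close> had value at least 1, so would the mean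
    with respect to \<open>w\<close>.\<close>
  have "\<exists>S\<in>Pow E. real (card (X S)) / K + real (card (Y S)) < 1"
  proof (rule ccontr)
    assume "\<not> ?thesis"
    then have ge: "1 \<le> real (card (X S)) / K + real (card (Y S))" if "S \<in> Pow E" for S
      using that by (meson not_le_imp_less)
    have "1 = (\<Sum>S\<in>Pow E. w S * 1)" using sum_w by simp
    also have "\<dots> \<le> (\<Sum>S\<in>Pow E. w S * (real (card (X S)) / K + real (card (Y S))))"
      by (intro sum_mono mult_left_mono ge w)
    also have "\<dots> = (\<Sum>S\<in>Pow E. w S * real (card (X S))) / K + (\<Sum>S\<in>Pow E. w S * real (card (Y S)))"
      by (simp add: distrib_left sum.distrib sum_divide_distrib)
    also have "\<dots> \<le> real N ^ card (fst G) * p ^ card (snd G) / K +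
               real (N choose n) * (1 - p) ^ (n choose 2)"
      unfolding sX sY cT using cF p K
      by (intro add_mono divide_right_mono mult_right_mono) auto
    finally show False using less by simp
  qed
  then obtain S where S: "S \<subseteq> E" "real (card (X S)) / K + real (card (Y S)) < 1" by auto
  \<comment> \<open>Both summands are nonnegative, so each is below 1; for the integer
    \<open>card (Y S)\<close> this means 0.\<close>
  have "real (card (Y S)) < 1" using S(2) K by (smt (verit) divide_nonneg_pos of_nat_0_le_iff)
  then have "card (Y S) = 0" by simp
  then have "Y S = {}" using finT by (simp add: Y_def)
  moreover have "real (card (X S)) / K < 1" using S(2) by simp
  then have "real (card (X S)) < K" using K by simp
  moreover have "X S = {f \<in> fst G \<rightarrow>\<^sub>E {..<N}. inj_on f (fst G) \<and> (\<forall>e\<in>snd G. f ` e \<in> S)}"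
    by (auto simp: X_def F_def)
  ultimately show ?thesis using S(1) that[of S] by (auto simp: E_def Y_def T_def)
qed

section \<open>From an edge set to a Ramsey lower bound\<close>

text \<open>Number \<open>r\<close> vertices of \<open>W\<close> by an injection \<open>h\<close>
  and colour a pair red iff its image lies in \<open>S\<close>. Composing with \<open>h\<close>
  turns a red copy of \<open>G\<close> into a copy inside \<open>W\<close>, and a blue clique into
  an independent \<open>n\<close>-set.\<close>

lemma not_ramsey_arrowI:
  assumes W: "finite W" "r \<le> card W"
    and noG: "\<And>f. inj_on f (fst G) \<Longrightarrow> f ` fst G \<subseteq> W \<Longrightarrow> \<exists>e\<in>snd G. f ` e \<notin> S"
    and noK: "\<And>T. T \<in> [W]\<^bsup>n\<^esup> \<Longrightarrow> [T]\<^bsup>2\<^esup> \<inter> S \<noteq> {}"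
  shows "\<not> ramsey_arrow r G (complete_graph n)"
proof
  assume arrow: "ramsey_arrow r G (complete_graph n)"
  obtain h where h: "inj_on h {..<r}" "h ` {..<r} \<subseteq> W"
    using card_le_inj[of "{..<r}" W] W by auto
  define c where "c e = (if h ` e \<in> S then Red else Blue)" for e
  from arrow consider "contains_copy (colour_class (complete_graph r) c Red) G"
    | "contains_copy (colour_class (complete_graph r) c Blue) (complete_graph n)"
    unfolding ramsey_arrow_def by blast
  then show False
  proof cases
    case 1
    then obtain f where f: "inj_on f (fst G)" "f ` fst G \<subseteq> {..<r}" "\<forall>e\<in>snd G. c (f ` e) = Red"
      by (auto simp: contains_copy_def colour_class_def complete_graph_def)
    have "inj_on (h \<circ> f) (fst G)" "(h \<circ> f) ` fst G \<subseteq> W"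
      using f(1,2) h by (auto intro!: comp_inj_on inj_on_subset[OF h(1)])
    from noG[OF this] obtain e where "e \<in> snd G" "h ` f ` e \<notin> S" by (auto simp: image_comp)
    then show False using f(3) by (auto simp: c_def split: if_splits)
  next
    case 2
    then obtain f where f: "inj_on f {..<n}" "f ` {..<n} \<subseteq> {..<r}"
        "\<forall>e\<in>[{..<n}]\<^bsup>2\<^esup>. c (f ` e) = Blue"
      by (auto simp: contains_copy_def colour_class_def complete_graph_def)
    define g where "g = h \<circ> f"
    have g: "inj_on g {..<n}" "g ` {..<n} \<subseteq> W"
      using f(1,2) h by (auto simp: g_def intro!: comp_inj_on inj_on_subset[OF h(1)])
    then have "g ` {..<n} \<in> [W]\<^bsup>n\<^esup>" by (auto simp: nsets_def card_image)
    from noK[OF this] obtain e where e: "e \<in> [g ` {..<n}]\<^bsup>2\<^esup>" "e \<in> S" by blast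
    from e(1) obtain x y where "e = {x, y}" "x \<in> g ` {..<n}" "y \<in> g ` {..<n}" "x \<noteq> y"
      by (rule nsets2_E)
    with e(2) obtain i j where "i < n" "j < n" "g i \<noteq> g j" "{g i, g j} \<in> S" by auto
    then show False
      using f(3)[rule_format, of "{i, j}"] by (auto simp: c_def g_def split: if_splits)
  qed
qed

text \<open>The deletion step: fewer than \<open>K\<close> labelled copies exist, so removing one
  vertex of each leaves more than \<open>N - K\<close> vertices. This destroys all copies and
  creates no independent \<open>n\<close>-set.\<close>

lemma ramsey_number_gt:
  fixes p K :: real and G :: "'a graph"
  assumes G: "finite (fst G)" "snd G \<subseteq> [fst G]\<^bsup>2\<^esup>" "fst G \<noteq> {}"
    and p: "0 \<le> p" "p \<le> 1" and K: "K > 0"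
    and less: "real N ^ card (fst G) * p ^ card (snd G) / K +
               real (N choose n) * (1 - p) ^ (n choose 2) < 1"
  shows "real N - K < real (ramsey_number G (complete_graph n))"
proof -
  obtain S where S: "S \<subseteq> [{..<N}]\<^bsup>2\<^esup>"
    "real (card {f \<in> fst G \<rightarrow>\<^sub>E {..<N}. inj_on f (fst G) \<and> (\<forall>e\<in>snd G. f ` e \<in> S)}) < K"
    "\<And>T. T \<in> [{..<N}]\<^bsup>n\<^esup> \<Longrightarrow> [T]\<^bsup>2\<^esup> \<inter> S \<noteq> {}"
    using ex_edge_set_few_copies[OF G(1,2) p K less] by blast
  define B where "B = {f \<in> fst G \<rightarrow>\<^sub>E {..<N}. inj_on f (fst G) \<and> (\<forall>e\<in>snd G. f ` e \<in> S)}"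
  \<comment> \<open>The deleted vertex of a copy \<open>f\<close> is the image of one fixed vertex
    \<open>v\<close> of \<open>G\<close>.\<close>
  obtain v where v: "v \<in> fst G" using G(3) by auto
  define W where "W = {..<N} - (\<lambda>f. f v) ` B"
  have "finite (fst G \<rightarrow>\<^sub>E {..<N})" using G(1) by (intro finite_PiE) auto
  then have finB: "finite B" unfolding B_def by simp
  have "N - card B \<le> N - card ((\<lambda>f. f v) ` B)"
    using card_image_le[OF finB] diff_le_mono2 by blast
  also have "\<dots> \<le> card W"
    unfolding W_def using diff_card_le_card_Diff[of "(\<lambda>f. f v) ` B" "{..<N}"] finB by simp
  finally have cW: "real N - K < real (card W)"
    using S(2) unfolding B_def[symmetric] by linarith
  have noG: "\<exists>e\<in>snd G. f ` e \<notin> S" if f: "inj_on f (fst G)" "f ` fst G \<subseteq> W" for f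
  proof (rule ccontr)
    assume neg: "\<not> ?thesis"
    \<comment> \<open>\<open>B\<close> holds only extensional functions, so \<open>f\<close> must be
      restricted before it can be recognised as a counted copy.\<close>
    define g where "g = restrict f (fst G)"
    have "g ` e = f ` e" if "e \<in> snd G" for e
      using that G(2) by (auto simp: g_def nsets_def intro!: image_cong)
    then have "g \<in> B"
      using neg f by (auto simp: B_def g_def W_def inj_on_def)
    moreover have "g v \<in> W" using f(2) v by (auto simp: g_def)
    ultimately show False by (auto simp: W_def)
  qed
  have W: "W \<subseteq> {..<N}" by (auto simp: W_def)
  have noK: "[T]\<^bsup>2\<^esup> \<inter> S \<noteq> {}" if "T \<in> [W]\<^bsup>n\<^esup>" for T
    using that nsets_mono[OF W] S(3) by blast
  \<comment> \<open>Existence ensures that the \<open>LEAST\<close> in \<open>ramsey_number\<close>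
    is attained, so the Ramsey number itself has the arrow property.\<close>
  have "\<exists>r. ramsey_arrow r G (complete_graph n)"
    by (rule ex_ramsey_arrow[OF G(1,2)]) (auto simp: complete_graph_def)
  then have "ramsey_arrow (ramsey_number G (complete_graph n)) G (complete_graph n)"
    unfolding ramsey_number_def by (rule LeastI_ex)
  then have "\<not> ramsey_number G (complete_graph n) \<le> card W"
    using not_ramsey_arrowI[OF finite_subset[OF W] _ noG noK] by blast
  then show ?thesis using cW by linarith
qed

section \<open>Cycles and estimates for fixed \<open>n\<close> and \<open>l\<close>\<close>

lemma cycle_graph_edges:
  assumes "l \<ge> 3"
  shows "snd (cycle_graph l) \<subseteq> [{..<l}]\<^bsup>2\<^esup>" "card (snd (cycle_graph l)) = l"
proof -
  have "i \<noteq> Suc i mod l" if "i < l" for i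
    using that assms by (cases "Suc i = l") auto
  then show "snd (cycle_graph l) \<subseteq> [{..<l}]\<^bsup>2\<^esup>"
    using assms by (auto simp: cycle_graph_def)
  have Suc_mod: "Suc i mod l = (if Suc i = l then 0 else Suc i)" if "i < l" for i
    using that by simp
  have "inj_on (\<lambda>i. {i, Suc i mod l}) {..<l}"
  proof (rule inj_onI)
    fix i j assume "i \<in> {..<l}" "j \<in> {..<l}" "{i, Suc i mod l} = {j, Suc j mod l}"
    \<comment> \<open>For \<open>l = 2\<close> the indices 0 and 1 would give the same edge;
      \<open>l \<ge> 3\<close> excludes this coincidence.\<close>
    then show "i = j"
      using assms by (auto simp: doubleton_eq_iff Suc_mod split: if_splits)
  qed
  moreover have "snd (cycle_graph l) = (\<lambda>i. {i, Suc i mod l}) ` {..<l}"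
    by (auto simp: cycle_graph_def)
  ultimately show "card (snd (cycle_graph l)) = l"
    by (simp add: card_image)
qed

text \<open>The left side divided by \<open>fact n\<close> is a single term of the exponential
  series at \<open>n\<close>.\<close>

lemma power_self_le_exp_fact: "real n ^ n \<le> exp (real n) * fact n"
proof -
  have "(\<Sum>i\<in>{n}. inverse (fact i) *\<^sub>R real n ^ i) \<le> exp (real n)"
    unfolding exp_def by (intro sum_le_suminf summable_exp_generic) auto
  then show ?thesis by (simp add: field_simps)
qed

lemma binomial_le_power_exp:
  assumes "n > 0"
  shows "real (N choose n) \<le> (exp 1 * real N / real n) ^ n"
proof -
  have "real (N choose n) * real n ^ n \<le> real (N choose n) * (exp (real n) * fact n)"
    by (intro mult_left_mono power_self_le_exp_fact) auto
  also have "\<dots> = exp (real n) * real ((N choose n) * fact n)" by simp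
  also have "\<dots> \<le> exp (real n) * real (N ^ n)"
    using binomial_fact_pow[of N n] by (intro mult_left_mono) (simp_all del: of_nat_mult of_nat_power)
  finally show ?thesis
    using assms by (simp add: power_divide power_mult_distrib field_simps flip: exp_of_nat_mult)
qed

text \<open>Collects what is required of a single \<open>n\<close>. Here \<open>c\<close> stands for
  \<open>ln (ln n)\<close> and \<open>b\<close> for the upper end of the range of \<open>l\<close>;
  only \<open>b\<close> enters the numerical conditions, which makes the later threshold uniform in
  \<open>l\<close>.\<close>

lemma ramsey_cycle_gt:
  fixes n l :: nat and b P c :: real
  defines "P \<equiv> log 2 (real n)"
  assumes l: "l \<ge> 3" "real l \<le> b"
    and n: "n \<ge> 2" "1 \<le> real n * P"
    and c: "0 \<le> c" "8 * c \<le> real n" "1 \<le> 24 * P * c"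
    and indep: "3 * exp 1 * P * exp (- 2 * c) \<le> 1 / 4"
    and copies: "exp (b * ln (24 * P * c)) < 3 / 4 * (real n * P)"
  shows "real (ramsey_number (cycle_graph l) (complete_graph n)) > real n * P"
proof -
  \<comment> \<open>The deletion allowance will be \<open>K = n * P\<close>, so starting from
    \<open>2 * n * P\<close> vertices leaves the required \<open>n * P\<close>.\<close>
  define N where "N = nat \<lceil>2 * real n * P\<rceil>"
  define p where "p = 8 * c / real n"
  have P: "P > 0" using n by (simp add: P_def)
  have p: "0 \<le> p" "p \<le> 1" using n c by (auto simp: p_def field_simps)
  \<comment> \<open>Rounding up costs less than 1, which is at most \<open>n * P\<close>; hence the
    factor 3.\<close>
  have N: "2 * real n * P \<le> real N" "real N \<le> 3 * real n * P"
    using n(2) unfolding N_def by linarith+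
  have "real N * p \<le> 3 * real n * P * p"
    using N(2) p(1) by (rule mult_right_mono)
  also have "\<dots> = 24 * P * c" using n by (simp add: p_def)
  finally have "(real N * p) ^ l \<le> (24 * P * c) ^ l"
    using p by (intro power_mono) auto
  also have "\<dots> = exp (real l * ln (24 * P * c))"
    using c by (simp add: exp_of_nat_mult)
  \<comment> \<open>Monotone in the exponent because \<open>24 * P * c \<ge> 1\<close> makes the
    logarithm nonnegative.\<close>
  also have "\<dots> \<le> exp (b * ln (24 * P * c))"
    using l(2) c(3) by (simp add: mult_right_mono)
  also note copies
  finally have "real N ^ l * p ^ l / (real n * P) < 3 / 4"
    using n by (simp add: power_mult_distrib field_simps)
  moreover have "real (N choose n) * (1 - p) ^ (n choose 2) \<le> 1 / 4"
  proof -
    have "(1 - p) ^ (n choose 2) \<le> exp (- p) ^ (n choose 2)"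
      using p exp_ge_add_one_self[of "- p"] by (intro power_mono) auto
    also have "\<dots> = exp (- p * real (n choose 2))" by (rule exp_of_nat2_mult[symmetric])
    also have "real (n choose 2) = real n * (real n - 1) / 2"
      using n by (simp add: choose_two real_of_nat_div of_nat_diff)
    also have "- p * (real n * (real n - 1) / 2) = real n * (- (p * (real n - 1) / 2))" by simp
    also have "\<dots> \<le> real n * (- 2 * c)"
    \<comment> \<open>The constant 8 in \<open>p\<close> gives
      \<open>p * (n - 1) / 2 = 4 * c * (n - 1) / n\<close>, which is at least \<open>2 * c\<close>
      since \<open>n \<ge> 2\<close>.\<close>
    proof (intro mult_left_mono)
      have "2 * c * 1 \<le> 2 * c * (2 * (real n - 1) / real n)"
        using n c by (intro mult_left_mono) (auto simp: field_simps)
      also have "\<dots> = p * (real n - 1) / 2" by (simp add: p_def)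
      finally show "- (p * (real n - 1) / 2) \<le> - 2 * c" by simp
    qed auto
    also have "exp (real n * (- 2 * c)) = exp (- 2 * c) ^ n" by (rule exp_of_nat_mult)
    finally have "real (N choose n) * (1 - p) ^ (n choose 2)
        \<le> (exp 1 * real N / real n) ^ n * exp (- 2 * c) ^ n"
      using n p by (intro mult_mono binomial_le_power_exp) auto
    also have "\<dots> = (exp 1 * (real N / real n) * exp (- 2 * c)) ^ n"
      by (simp flip: power_mult_distrib)
    also have "\<dots> \<le> (exp 1 * (3 * P) * exp (- 2 * c)) ^ n"
      using N(2) n by (intro power_mono mult_right_mono mult_left_mono) (auto simp: field_simps)
    also have "\<dots> \<le> (1 / 4) ^ n"
      using indep P by (intro power_mono) (auto simp: mult_ac)
    also have "\<dots> \<le> (1 / 4) ^ 1" using n by (intro power_decreasing) auto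
    finally show ?thesis by simp
  qed
  ultimately have "real N ^ l * p ^ l / (real n * P) + real (N choose n) * (1 - p) ^ (n choose 2) < 1"
    by linarith
  then have "real N ^ card (fst (cycle_graph l)) * p ^ card (snd (cycle_graph l)) / (real n * P)
      + real (N choose n) * (1 - p) ^ (n choose 2) < 1"
    using cycle_graph_edges(2)[OF l(1)] by (simp add: cycle_graph_def)
  then have "real N - real n * P < real (ramsey_number (cycle_graph l) (complete_graph n))"
    using cycle_graph_edges(1)[OF l(1)] l(1) n p
    by (intro ramsey_number_gt) (auto simp: cycle_graph_def lessThan_empty_iff)
  then show ?thesis using N(1) by linarith
qed

section \<open>Asymptotics in \<open>n\<close>\<close>

lemma eventually_cycle_copies_bound:
  fixes \<epsilon> :: real
  assumes "\<epsilon> > 0"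
  shows "\<forall>\<^sub>F n::nat in sequentially.
    exp ((1 - \<epsilon>) * (log 2 (real n) / log 2 (log 2 (real n))) * ln (24 * log 2 (real n) * ln (ln (real n))))
      < 3 / 4 * (real n * log 2 (real n))"
proof -
  \<comment> \<open>Apart from the factor \<open>1 - \<epsilon>\<close>, this is the exponent
    divided by \<open>ln n\<close>. Changing the base of the logarithms reduces it to
    \<open>ln (24 * P * ln (ln n)) / ln P\<close> with \<open>P = log 2 n\<close>, where the factor
    \<open>24 * ln (ln n)\<close> is negligible on the logarithmic scale.\<close>
  let ?f = "\<lambda>n::nat. log 2 (real n) / log 2 (log 2 (real n)) * ln (24 * log 2 (real n) * ln (ln (real n))) / ln (real n)"
  have "?f \<longlonglongrightarrow> 1" by real_asymp
  then have "(\<lambda>n. (1 - \<epsilon>) * ?f n) \<longlonglongrightarrow> (1 - \<epsilon>) * 1" by (intro tendsto_intros)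
  then have "\<forall>\<^sub>F n in sequentially. (1 - \<epsilon>) * ?f n < 1"
    using assms by (intro order_tendstoD) auto
  moreover have "\<forall>\<^sub>F n::nat in sequentially. ln (real n) > 0 \<and> log 2 (real n) \<ge> 2"
    by (intro eventually_conj; real_asymp)
  ultimately show ?thesis
    using eventually_gt_at_top[of 0]
  proof eventually_elim
    case (elim n)
    then have "(1 - \<epsilon>) * (log 2 (real n) / log 2 (log 2 (real n))) * ln (24 * log 2 (real n) * ln (ln (real n)))
        < ln (real n)"
      by (simp only: times_divide_eq_right times_divide_eq_left pos_divide_less_eq mult_1_left mult.assoc)
    then have "exp ((1 - \<epsilon>) * (log 2 (real n) / log 2 (log 2 (real n))) * ln (24 * log 2 (real n) * ln (ln (real n))))
        < exp (ln (real n))"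
      by (simp only: exp_less_cancel_iff)
    also have "\<dots> = real n * 1" using elim by simp
    also have "\<dots> \<le> real n * (3 / 4 * log 2 (real n))"
      using elim by (intro mult_left_mono) auto
    finally show ?case by simp
  qed
qed

theorem theorem1p2:
  fixes \<epsilon> :: real
  assumes "\<epsilon> > 0"
  shows "(\<exists>n0::nat. \<forall>n\<ge>n0. \<forall>l::nat.
            3 \<le> l \<and> real l \<le> (1 - \<epsilon>) * (log 2 (real n) / log 2 (log 2 (real n))) \<longrightarrow>
            real (ramsey_number (cycle_graph l) (complete_graph n)) > real n * log 2 (real n)) \<and>
         (\<forall>\<delta>>0. \<exists>n1::nat. \<forall>n\<ge>n1. \<forall>l::nat.
            3 \<le> l \<and> real l \<le> (1 - \<epsilon>) * (log 2 (real n) / log 2 (log 2 (real n))) \<longrightarrow>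
            \<bar>((real l - 1) * (real n - 1) + 1) / (real n * log 2 (real n))\<bar> < \<delta>)"
proof (intro conjI allI impI)
  \<comment> \<open>The hypotheses of \<open>ramsey_cycle_gt\<close> for
    \<open>c = ln (ln n)\<close>. In the last one, \<open>exp (- 2 * c)\<close> is
    \<open>1 / (ln n)^2\<close>, which beats the factor \<open>log 2 n\<close>.\<close>
  have "\<forall>\<^sub>F n::nat in sequentially. n \<ge> 2 \<and> 1 \<le> real n * log 2 (real n) \<and> 0 \<le> ln (ln (real n)) \<and>
      8 * ln (ln (real n)) \<le> real n \<and> 1 \<le> 24 * log 2 (real n) * ln (ln (real n)) \<and>
      3 * exp 1 * log 2 (real n) * exp (- 2 * ln (ln (real n))) \<le> 1 / 4"
    by (intro eventually_conj eventually_ge_at_top; real_asymp)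
  with eventually_cycle_copies_bound[OF assms]
  have "\<forall>\<^sub>F n::nat in sequentially. \<forall>l::nat.
      3 \<le> l \<and> real l \<le> (1 - \<epsilon>) * (log 2 (real n) / log 2 (log 2 (real n))) \<longrightarrow>
      real (ramsey_number (cycle_graph l) (complete_graph n)) > real n * log 2 (real n)"
    by eventually_elim (auto intro!: ramsey_cycle_gt)
  then show "\<exists>n0::nat. \<forall>n\<ge>n0. \<forall>l::nat.
      3 \<le> l \<and> real l \<le> (1 - \<epsilon>) * (log 2 (real n) / log 2 (log 2 (real n))) \<longrightarrow>
      real (ramsey_number (cycle_graph l) (complete_graph n)) > real n * log 2 (real n)"
    by (simp only: eventually_sequentially)
next
  fix \<delta> :: real assume "\<delta> > 0"
  \<comment> \<open>The ratio is at most \<open>l / log 2 n\<close>, which the range of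
    \<open>l\<close> bounds by this sequence, independent of \<open>l\<close>.\<close>
  have "(\<lambda>n::nat. 1 / log 2 (log 2 (real n))) \<longlonglongrightarrow> 0" by real_asymp
  then have "\<forall>\<^sub>F n::nat in sequentially. 1 / log 2 (log 2 (real n)) < \<delta>"
    using \<open>\<delta> > 0\<close> by (rule order_tendstoD)
  moreover have "\<forall>\<^sub>F n::nat in sequentially. n > 0 \<and> log 2 (real n) > 0 \<and> log 2 (log 2 (real n)) > 0"
    by (intro eventually_conj eventually_gt_at_top; real_asymp)
  ultimately have "\<forall>\<^sub>F n::nat in sequentially. \<forall>l::nat.
      3 \<le> l \<and> real l \<le> (1 - \<epsilon>) * (log 2 (real n) / log 2 (log 2 (real n))) \<longrightarrow>
      \<bar>((real l - 1) * (real n - 1) + 1) / (real n * log 2 (real n))\<bar> < \<delta>"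
  proof eventually_elim
    case (elim n)
    show ?case
    proof (intro allI impI, elim conjE)
      fix l :: nat
      assume l: "3 \<le> l" "real l \<le> (1 - \<epsilon>) * (log 2 (real n) / log 2 (log 2 (real n)))"
      note l(2)
      also have "(1 - \<epsilon>) * (log 2 (real n) / log 2 (log 2 (real n)))
          \<le> 1 * (log 2 (real n) / log 2 (log 2 (real n)))"
        using elim assms by (intro mult_right_mono) auto
      finally have l': "real l / log 2 (real n) \<le> 1 / log 2 (log 2 (real n))"
        using elim by (simp add: field_simps)
      have nonneg: "0 \<le> (real l - 1) * (real n - 1)"
        using l(1) elim by simp
      have "(real l - 1) * (real n - 1) + 1 = real l * real n - (real l - 1) - (real n - 1)"
        by (simp add: algebra_simps)
      also have "\<dots> \<le> real l * real n" using l(1) elim by simp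
      finally have "((real l - 1) * (real n - 1) + 1) / (real n * log 2 (real n))
          \<le> real l * real n / (real n * log 2 (real n))"
        using elim by (intro divide_right_mono) auto
      also have "\<dots> = real l / log 2 (real n)" using elim by simp
      also note l'
      finally have "((real l - 1) * (real n - 1) + 1) / (real n * log 2 (real n)) < \<delta>"
        using elim by linarith
      moreover have "0 \<le> ((real l - 1) * (real n - 1) + 1) / (real n * log 2 (real n))"
        using nonneg elim by simp
      ultimately show "\<bar>((real l - 1) * (real n - 1) + 1) / (real n * log 2 (real n))\<bar> < \<delta>"
        by simp
    qed
  qed
  then show "\<exists>n1::nat. \<forall>n\<ge>n1. \<forall>l::nat.
      3 \<le> l \<and> real l \<le> (1 - \<epsilon>) * (log 2 (real n) / log 2 (log 2 (real n))) \<longrightarrow>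
      \<bar>((real l - 1) * (real n - 1) + 1) / (real n * log 2 (real n))\<bar> < \<delta>"
    by (simp only: eventually_sequentially)
qed

end
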